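(* A flag matroid is graphic if and only if it has a major that is a graphic matroid.
   Context: A flag matroid on a finite set $E$ is a sequence $(M_1,\dots,M_k)$ of matroids on $E$ (its sequential representation) such that each $M_{i+1}$ is a nontrivial lift of $M_i$: every flat of $M_i$ is a flat of $M_{i+1}$ and $M_{i+1}\neq M_i$. A matroid $Q$ on ground set $E\sqcup X$ is a major of this flag matroid if $X$ is independent in $Q$ and there is an ordered partition $X=X_1\cup\dots\cup X_{k-1}$ such that $M_i=Q/(X_1\cup\dots\cup X_{i-1})\setminus(X_i\cup\dots\cup X_{k-1})$ for $i=1,\dots,k$. A matroid is graphic if it is the cycle matroid $M(G)$ of a graph $G$ (graphs may have loops and multiple edges). For partitions, $\mathcal{P}\succ\mathcal{Q}$ means $\mathcal{Q}$ is finer than $\mathcal{P}$. For a graph $G=(V,E)$ and a partition $\mathcal{P}$ of $V$, let $e^{\mathcal{P}}$ be the edge joining the cells containing the endpoints of $e$; $M(G,\mathcal{P})$ is the matroid on $E$ in which $S$ is independent iff the multigraph on the cells of $\mathcal{P}$ with edges $\{e^{\mathcal{P}}:e\in S\}$ has no cycles (loops count as cycles). A flag matroid is graphic if there exist a graph $G=(V,E)$ and a chain of partitions $\mathcal{P}_1\succ\dots\succ\mathcal{P}_k$ of $V$ such that its sequential representation is $(M(G,\mathcal{P}_1),\dots,M(G,\mathcal{P}_k))$.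
   Formalization: In the definition of major, contraction and deletion are exchanged: M_i = Q/(X_i∪…∪X_{k-1}) \ (X_1∪…∪X_{i-1}), since as printed ranks would not increase along the flag and no flag matroid with k ≥ 2 (e.g. U_{0,1}, U_{1,1}) could have a major. *)

theory Defs
  imports Main "HOL-Library.Disjoint_Sets"
begin

section \<open>Matroids\<close>

record 'a matroid =
  ground :: "'a set"
  indep :: "'a set set"

definition is_matroid :: "'a matroid \<Rightarrow> bool" where
  "is_matroid M \<longleftrightarrow>
     finite (ground M) \<and>
     indep M \<subseteq> Pow (ground M) \<and>
     {} \<in> indep M \<and>
     (\<forall>I J. J \<in> indep M \<and> I \<subseteq> J \<longrightarrow> I \<in> indep M) \<and>
     (\<forall>I J. I \<in> indep M \<and> J \<in> indep M \<and> card I < card J \<longrightarrow>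
        (\<exists>x\<in>J - I. insert x I \<in> indep M))"

definition rank :: "'a matroid \<Rightarrow> 'a set \<Rightarrow> nat" where
  "rank M A = Max (card ` {I \<in> indep M. I \<subseteq> A})"

definition flat :: "'a matroid \<Rightarrow> 'a set \<Rightarrow> bool" where
  "flat M F \<longleftrightarrow> F \<subseteq> ground M \<and> (\<forall>x\<in>ground M - F. rank M F < rank M (insert x F))"

definition basis_of :: "'a matroid \<Rightarrow> 'a set \<Rightarrow> 'a set \<Rightarrow> bool" where
  "basis_of M A B \<longleftrightarrow>
     B \<in> indep M \<and> B \<subseteq> A \<and> (\<forall>I\<in>indep M. B \<subseteq> I \<and> I \<subseteq> A \<longrightarrow> I = B)"

definition delete :: "'a matroid \<Rightarrow> 'a set \<Rightarrow> 'a matroid" where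
  "delete M D = \<lparr>ground = ground M - D, indep = {I \<in> indep M. I \<subseteq> ground M - D}\<rparr>"

definition contract :: "'a matroid \<Rightarrow> 'a set \<Rightarrow> 'a matroid" where
  "contract M C =
     \<lparr>ground = ground M - C,
      indep = {I. I \<subseteq> ground M - C \<and> (\<exists>B. basis_of M C B \<and> I \<union> B \<in> indep M)}\<rparr>"

definition relabel :: "('a \<Rightarrow> 'b) \<Rightarrow> 'a matroid \<Rightarrow> 'b matroid" where
  "relabel f M = \<lparr>ground = f ` ground M, indep = (`) f ` indep M\<rparr>"


section \<open>Flag matroids and majors\<close>

definition nontrivial_lift :: "'a matroid \<Rightarrow> 'a matroid \<Rightarrow> bool" where
  "nontrivial_lift N M \<longleftrightarrow> (\<forall>F. flat M F \<longrightarrow> flat N F) \<and> N \<noteq> M"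

definition flag_matroid :: "'a set \<Rightarrow> 'a matroid list \<Rightarrow> bool" where
  "flag_matroid E Ms \<longleftrightarrow>
     finite E \<and> Ms \<noteq> [] \<and>
     (\<forall>M\<in>set Ms. is_matroid M \<and> ground M = E) \<and>
     successively (\<lambda>M N. nontrivial_lift N M) Ms"

text \<open>
  The ground set of a major is the disjoint union of \<open>E\<close> and \<open>X\<close>, so the members of the
  flag are compared with minors of \<open>Q\<close> along \<open>Inl\<close>. With \<open>Ms = [M\<^sub>1, \<dots>, M\<^sub>k]\<close> and
  \<open>Xs = [X\<^sub>1, \<dots>, X\<^sub>k\<^sub>-\<^sub>1]\<close>, the matroid \<open>M\<^sub>i\<close> arises by contracting \<open>X\<^sub>i, \<dots>, X\<^sub>k\<^sub>-\<^sub>1\<close> and deleting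
  \<open>X\<^sub>1, \<dots>, X\<^sub>i\<^sub>-\<^sub>1\<close>. Thus \<open>M\<^sub>1\<close> is \<open>Q\<close> with all of \<open>X\<close> contracted and \<open>M\<^sub>k\<close> is \<open>Q\<close> with all of \<open>X\<close>
  deleted, which is the direction in which \<open>M\<^sub>i\<^sub>+\<^sub>1\<close> is a lift of \<open>M\<^sub>i\<close>; exchanging
  contraction and deletion would make the ranks decrease along the flag.
\<close>

definition major :: "'a set \<Rightarrow> 'a matroid list \<Rightarrow> ('a + 'b) matroid \<Rightarrow> bool" where
  "major E Ms Q \<longleftrightarrow>
     is_matroid Q \<and>
     (\<exists>X Xs. ground Q = E <+> X \<and> Inr ` X \<in> indep Q \<and>
        length Xs = length Ms - 1 \<and> distinct Xs \<and> partition_on X (set Xs) \<and>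
        (\<forall>i<length Ms. relabel Inl (Ms ! i) =
           delete (contract Q (Inr ` \<Union>(set (drop i Xs)))) (Inr ` \<Union>(set (take i Xs)))))"


section \<open>Graphs with loops and multiple edges\<close>

record ('v, 'e) multigraph =
  verts :: "'v set"
  edges :: "'e set"
  ends :: "'e \<Rightarrow> 'v set"

text \<open>An edge \<open>e\<close> is a loop iff \<open>ends G e\<close> is a singleton.\<close>

definition is_multigraph :: "('v, 'e) multigraph \<Rightarrow> bool" where
  "is_multigraph G \<longleftrightarrow>
     finite (verts G) \<and> finite (edges G) \<and>
     (\<forall>e\<in>edges G. ends G e \<subseteq> verts G \<and> card (ends G e) \<in> {1, 2})"

text \<open>Loops are the cycles of length 1; pairs of parallel edges are the cycles of length 2.\<close>

definition is_cycle :: "('v, 'e) multigraph \<Rightarrow> 'v list \<Rightarrow> 'e list \<Rightarrow> bool" where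
  "is_cycle G vs es \<longleftrightarrow>
     es \<noteq> [] \<and> length vs = length es \<and> distinct vs \<and> distinct es \<and>
     set vs \<subseteq> verts G \<and> set es \<subseteq> edges G \<and>
     (\<forall>i<length es. ends G (es ! i) = {vs ! i, vs ! (Suc i mod length es)})"

definition cycle_matroid :: "('v, 'e) multigraph \<Rightarrow> 'e matroid" where
  "cycle_matroid G =
     \<lparr>ground = edges G,
      indep = {S. S \<subseteq> edges G \<and> \<not> (\<exists>vs es. is_cycle G vs es \<and> set es \<subseteq> S)}\<rparr>"

text \<open>
  Every finite graph is isomorphic, by an isomorphism fixing the edges, to one whose
  vertices are natural numbers.
\<close>

definition graphic_matroid :: "'e matroid \<Rightarrow> bool" where
  "graphic_matroid M \<longleftrightarrow>
     (\<exists>G :: (nat, 'e) multigraph. is_multigraph G \<and> M = cycle_matroid G)"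

definition cell_graph :: "('v, 'e) multigraph \<Rightarrow> 'v set set \<Rightarrow> ('v set, 'e) multigraph" where
  "cell_graph G P =
     \<lparr>verts = P, edges = edges G, ends = (\<lambda>e. {C \<in> P. C \<inter> ends G e \<noteq> {}})\<rparr>"

definition partition_matroid :: "('v, 'e) multigraph \<Rightarrow> 'v set set \<Rightarrow> 'e matroid" where
  "partition_matroid G P = cycle_matroid (cell_graph G P)"

definition graphic_flag_matroid :: "'e set \<Rightarrow> 'e matroid list \<Rightarrow> bool" where
  "graphic_flag_matroid E Ms \<longleftrightarrow>
     (\<exists>(G :: (nat, 'e) multigraph) Ps.
        is_multigraph G \<and> edges G = E \<and>
        (\<forall>P\<in>set Ps. partition_on (verts G) P) \<and>
        successively (\<lambda>P Q. refines (verts G) Q P \<and> Q \<noteq> P) Ps \<and>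
        Ms = map (partition_matroid G) Ps)"

end

theory Submission
  imports Defs
begin

text \<open>
  Contracting a forest \<open>C\<close> of a graph identifies the vertices of each component of \<open>C\<close>. Given a
  graphic major \<open>M(H)\<close>, the components of \<open>X\<^sub>i \<union> \<dots> \<union> X\<^sub>k\<^sub>-\<^sub>1\<close> therefore form the \<open>i\<close>-th partition;
  the chain is strict because \<open>X\<close> is a forest. Conversely, given a chain of partitions of
  \<open>V \<subseteq> \<nat>\<close>, collapse each cell of the finest one to its least element. For each such element \<open>r\<close>
  that is not the least of its cell in the coarsest partition, add an edge, labelled \<open>r\<close>, joining
  \<open>r\<close> to the least element of its cell in the finest partition \<open>\<P>\<^sub>i\<close> in which \<open>r\<close> is not
  least, and put this edge into \<open>X\<^sub>i\<close>. Every new edge joins its label to a smaller vertex, so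
  \<open>X\<close> is a forest, and \<open>X\<^sub>i \<union> \<dots> \<union> X\<^sub>k\<^sub>-\<^sub>1\<close> connects exactly the cells of \<open>\<P>\<^sub>i\<close>.
\<close>

section \<open>Connectivity and forests\<close>

text \<open>The closure is reflexive on the whole type, so components are classes of an equivalence
  on \<open>UNIV\<close>; a vertex set enters only through quotients
  \<open>V // edge_conn g S\<close>.\<close>

definition edge_conn :: "('e \<Rightarrow> 'v set) \<Rightarrow> 'e set \<Rightarrow> 'v rel" where
  "edge_conn g S = (\<Union>e\<in>S. g e \<times> g e)\<^sup>*"

text \<open>Acyclicity in the form "every edge is a bridge". Reflexivity of \<open>edge_conn\<close>
  makes this exclude loops, where \<open>u = v\<close>.\<close>

definition forest :: "('e \<Rightarrow> 'v set) \<Rightarrow> 'e set \<Rightarrow> bool" where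
  "forest g S \<longleftrightarrow> (\<forall>e\<in>S. \<forall>u v. g e = {u, v} \<longrightarrow> (u, v) \<notin> edge_conn g (S - {e}))"

lemma edge_conn_refl [simp]: "(x, x) \<in> edge_conn g S"
  by (simp add: edge_conn_def)

lemma edge_conn_sym: "(x, y) \<in> edge_conn g S \<Longrightarrow> (y, x) \<in> edge_conn g S"
proof -
  have "sym (\<Union>e\<in>S. g e \<times> g e)"
    by (auto simp: sym_def)
  then show "(x, y) \<in> edge_conn g S \<Longrightarrow> (y, x) \<in> edge_conn g S"
    unfolding edge_conn_def using sym_rtrancl symD by metis
qed

lemma edge_conn_trans:
  "(x, y) \<in> edge_conn g S \<Longrightarrow> (y, z) \<in> edge_conn g S \<Longrightarrow> (x, z) \<in> edge_conn g S"
  unfolding edge_conn_def by (rule rtrancl_trans)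

lemma edge_conn_edge: "e \<in> S \<Longrightarrow> x \<in> g e \<Longrightarrow> y \<in> g e \<Longrightarrow> (x, y) \<in> edge_conn g S"
  unfolding edge_conn_def by (rule r_into_rtrancl) blast

lemma edge_conn_mono: "S \<subseteq> T \<Longrightarrow> edge_conn g S \<subseteq> edge_conn g T"
  unfolding edge_conn_def by (rule rtrancl_mono) blast

lemma equiv_edge_conn: "equiv UNIV (edge_conn g S)"
proof (rule equivI)
  show "refl (edge_conn g S)" by (simp add: refl_on_def)
  show "sym (edge_conn g S)" by (rule symI) (rule edge_conn_sym)
  show "trans (edge_conn g S)" by (rule transI) (rule edge_conn_trans)
qed auto

lemma edge_conn_subset:
  assumes "\<And>e. e \<in> S \<Longrightarrow> g e \<times> g e \<subseteq> edge_conn g T"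
  shows "edge_conn g S \<subseteq> edge_conn g T"
proof -
  have "(\<Union>e\<in>S. g e \<times> g e) \<subseteq> edge_conn g T"
    using assms by blast
  then show ?thesis
    unfolding edge_conn_def using rtrancl_subset_rtrancl by blast
qed

lemma edge_conn_closed:
  assumes "(x, y) \<in> edge_conn g S" "x \<in> V" "\<And>e. e \<in> S \<Longrightarrow> g e \<subseteq> V"
  shows "y \<in> V"
  using assms(1,2) unfolding edge_conn_def
  by (induction rule: rtrancl_induct) (use assms(3) in auto)

lemma edge_conn_eq_classes:
  "edge_conn g S `` {x} = edge_conn g S `` {y} \<longleftrightarrow> (x, y) \<in> edge_conn g S"
  using equiv_edge_conn[of g S] by (simp add: eq_equiv_class_iff)

text \<open>Both ends of \<open>e\<close> are reached by the time of its first crossing, so a walk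
  need cross it at most once, in one of two directions.\<close>

lemma edge_conn_insert:
  assumes "g e = {a, b}"
  shows "(x, y) \<in> edge_conn g (insert e S) \<longleftrightarrow>
    (x, y) \<in> edge_conn g S \<or>
    (x, a) \<in> edge_conn g S \<and> (b, y) \<in> edge_conn g S \<or>
    (x, b) \<in> edge_conn g S \<and> (a, y) \<in> edge_conn g S" (is "?L \<longleftrightarrow> ?R x y")
proof
  assume ?L
  then show "?R x y" unfolding edge_conn_def[of g "insert e S"]
  proof (induction rule: rtrancl_induct)
    case base
    then show ?case by simp
  next
    case (step y z)
    from step(2) obtain f where f: "f \<in> insert e S" "y \<in> g f" "z \<in> g f" by blast
    consider "(y, z) \<in> edge_conn g S" | "y \<in> {a, b}" "z \<in> {a, b}"
      using f assms edge_conn_edge[of f S y g z] by (cases "f = e") auto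
    then show ?case
    proof cases
      case 1
      then show ?thesis using step(3) edge_conn_trans by meson
    next
      case 2
      then show ?thesis using step(3) by auto
    qed
  qed
next
  have *: "edge_conn g S \<subseteq> edge_conn g (insert e S)"
    by (rule edge_conn_mono) blast
  have "(a, b) \<in> edge_conn g (insert e S)" "(b, a) \<in> edge_conn g (insert e S)"
    using assms by (auto intro: edge_conn_edge)
  moreover assume "?R x y"
  ultimately show ?L using * by (meson edge_conn_trans subsetD)
qed

lemma forest_mono: "forest g T \<Longrightarrow> S \<subseteq> T \<Longrightarrow> forest g S"
  unfolding forest_def using edge_conn_mono[of "S - {e}" "T - {e}" g for e] by blast

text \<open>If \<open>e\<close> destroyed the bridge property of an old edge \<open>f\<close>, a
  path joining the ends of \<open>f\<close> without \<open>f\<close> would run through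
  \<open>e\<close>; closing it up by \<open>f\<close> would join \<open>a\<close> and
  \<open>b\<close> inside \<open>S\<close>.\<close>

lemma forest_insert:
  assumes "forest g S" "e \<notin> S" "g e = {a, b}" "(a, b) \<notin> edge_conn g S"
  shows "forest g (insert e S)"
  unfolding forest_def
proof (intro ballI allI impI notI)
  fix f c d
  assume f: "f \<in> insert e S" "g f = {c, d}" and cd: "(c, d) \<in> edge_conn g (insert e S - {f})"
  show False
  proof (cases "f = e")
    case True
    then have "{c, d} = {a, b}" "(c, d) \<in> edge_conn g S"
      using f cd assms(2,3) by auto
    then show False
      using assms(4) edge_conn_sym by (metis doubleton_eq_iff)
  next
    case False
    then have fS: "f \<in> S" and "insert e S - {f} = insert e (S - {f})"
      using f by auto
    then have "(c, d) \<in> edge_conn g (S - {f}) \<or>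
        (c, a) \<in> edge_conn g (S - {f}) \<and> (b, d) \<in> edge_conn g (S - {f}) \<or>
        (c, b) \<in> edge_conn g (S - {f}) \<and> (a, d) \<in> edge_conn g (S - {f})"
      using cd assms(3) by (simp add: edge_conn_insert)
    moreover have "(c, d) \<notin> edge_conn g (S - {f})"
      using assms(1) fS f(2) unfolding forest_def by blast
    moreover have "edge_conn g (S - {f}) \<subseteq> edge_conn g S"
      by (rule edge_conn_mono) blast
    moreover have "(c, d) \<in> edge_conn g S"
      using fS f(2) by (auto intro: edge_conn_edge)
    ultimately have "(a, b) \<in> edge_conn g S"
      by (meson edge_conn_sym edge_conn_trans subsetD)
    then show False using assms(4) by blast
  qed
qed

text \<open>The edges of \<open>I\<close> join \<open>C\<close> one at a time by
  \<open>forest_insert\<close>. Only edges of \<open>I\<close> are tested for being bridges, which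
  is what acyclicity after contracting \<open>C\<close> provides.\<close>

lemma forest_Un:
  assumes "forest g C" "finite I" "I \<inter> C = {}"
    and "\<And>e. e \<in> I \<Longrightarrow> \<exists>a b. g e = {a, b}"
    and "\<And>e a b. e \<in> I \<Longrightarrow> g e = {a, b} \<Longrightarrow> (a, b) \<notin> edge_conn g (C \<union> (I - {e}))"
  shows "forest g (I \<union> C)"
  using assms(2-5)
proof (induction I rule: finite_induct)
  case empty
  then show ?case using assms(1) by simp
next
  case (insert x I)
  obtain a b where ab: "g x = {a, b}" using insert.prems(2) by blast
  have "forest g (I \<union> C)"
  proof (rule insert.IH)
    fix e a b assume e: "e \<in> I" "g e = {a, b}"
    have "edge_conn g (C \<union> (I - {e})) \<subseteq> edge_conn g (C \<union> (insert x I - {e}))"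
      by (rule edge_conn_mono) blast
    then show "(a, b) \<notin> edge_conn g (C \<union> (I - {e}))"
      using insert.prems(3)[of e a b] e by blast
  qed (use insert.prems in auto)
  moreover have "(a, b) \<notin> edge_conn g (I \<union> C)"
    using insert.prems(3)[of x a b] ab insert.hyps(2) by (simp add: Un_commute)
  moreover have "x \<notin> I \<union> C" using insert by blast
  ultimately show ?case using forest_insert[of g "I \<union> C" x a b] ab by simp
qed

text \<open>Each edge inserted into a forest merges exactly two classes. This is the rank formula:
  vertices minus components.\<close>

lemma card_edge_conn_classes:
  assumes "finite S" "finite V" "forest g S"
    and "\<And>e. e \<in> S \<Longrightarrow> \<exists>a\<in>V. \<exists>b\<in>V. g e = {a, b}"
  shows "card (V // edge_conn g S) + card S = card V"
  using assms(1,3,4)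
proof (induction S rule: finite_induct)
  case empty
  have "V // edge_conn g {} = (\<lambda>v. {v}) ` V"
    by (auto simp: quotient_def edge_conn_def)
  then show ?case by (simp add: card_image)
next
  case (insert e S)
  obtain a b where ab: "a \<in> V" "b \<in> V" "g e = {a, b}" using insert.prems(2) by blast
  let ?R = "edge_conn g S" and ?R' = "edge_conn g (insert e S)"
  define A where "A = ?R `` {a}"
  define B where "B = ?R `` {b}"
  have nab: "(a, b) \<notin> ?R"
    using insert.prems(1) insert.hyps(2) ab(3) unfolding forest_def by fastforce
  then have AB: "A \<noteq> B" "A \<inter> B = {}"
    unfolding A_def B_def edge_conn_eq_classes
    by (blast, metis (no_types, lifting) Image_singleton_iff disjoint_iff edge_conn_sym edge_conn_trans)
  have AV: "A \<in> V // ?R" "B \<in> V // ?R" using ab by (auto simp: A_def B_def quotientI)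
  have fin: "finite (V // ?R)" using assms(2) by (simp add: quotient_def)
  have memA: "x \<in> A \<longleftrightarrow> (a, x) \<in> ?R" and memB: "x \<in> B \<longleftrightarrow> (b, x) \<in> ?R" for x
    by (auto simp: A_def B_def)
  have cls: "?R' `` {x} = (if x \<in> A \<union> B then A \<union> B else ?R `` {x})" for x
  proof (rule set_eqI)
    fix y
    have "y \<in> ?R' `` {x} \<longleftrightarrow> (x, y) \<in> ?R \<or> x \<in> A \<and> y \<in> B \<or> x \<in> B \<and> y \<in> A"
      using edge_conn_insert[of g e a b x y S] ab(3) memA memB edge_conn_sym by fastforce
    moreover have "x \<in> A \<Longrightarrow> (x, y) \<in> ?R \<longleftrightarrow> y \<in> A" "x \<in> B \<Longrightarrow> (x, y) \<in> ?R \<longleftrightarrow> y \<in> B"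
      unfolding memA memB by (meson edge_conn_sym edge_conn_trans)+
    ultimately show "y \<in> ?R' `` {x} \<longleftrightarrow> y \<in> (if x \<in> A \<union> B then A \<union> B else ?R `` {x})"
      by auto
  qed
  have clsA: "?R `` {x} = A \<longleftrightarrow> x \<in> A" and clsB: "?R `` {x} = B \<longleftrightarrow> x \<in> B" for x
    unfolding A_def B_def edge_conn_eq_classes by (auto intro: edge_conn_sym)
  have "V // ?R' = insert (A \<union> B) (V // ?R - {A, B})"
  proof (intro equalityI subsetI)
    fix Z assume "Z \<in> V // ?R'"
    then obtain x where "x \<in> V" "Z = ?R' `` {x}" by (auto elim: quotientE)
    then show "Z \<in> insert (A \<union> B) (V // ?R - {A, B})"
      using cls[of x] clsA[of x] clsB[of x] by (auto simp: quotientI)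
  next
    fix Z assume "Z \<in> insert (A \<union> B) (V // ?R - {A, B})"
    then consider "Z = A \<union> B" | x where "x \<in> V" "Z = ?R `` {x}" "Z \<noteq> A" "Z \<noteq> B"
      by (auto elim: quotientE)
    then show "Z \<in> V // ?R'"
    proof cases
      case 1
      then have "Z = ?R' `` {a}" using cls[of a] by (simp add: memA)
      then show ?thesis using ab(1) by (simp add: quotientI)
    next
      case 2
      then have "Z = ?R' `` {x}" using cls[of x] clsA[of x] clsB[of x] by auto
      then show ?thesis using 2(1) by (simp add: quotientI)
    qed
  qed
  \<comment> \<open>The merged class is new, so losing \<open>A\<close> and \<open>B\<close> and
    gaining \<open>A \<union> B\<close> lowers the count by exactly one.\<close>
  moreover have "A \<union> B \<notin> V // ?R"
  proof
    assume "A \<union> B \<in> V // ?R"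
    then obtain x where "A \<union> B = ?R `` {x}" by (auto elim: quotientE)
    then have "(x, a) \<in> ?R" "(x, b) \<in> ?R" using memA memB by auto
    then show False using nab by (meson edge_conn_sym edge_conn_trans)
  qed
  moreover have "card (V // ?R - {A, B}) = card (V // ?R) - 2"
    using AB AV fin by (simp add: card_Diff_subset)
  moreover have "card (V // ?R) \<ge> 2"
    using card_mono[OF fin, of "{A, B}"] AV AB by simp
  ultimately have "card (V // ?R') = card (V // ?R) - 1" using fin by simp
  moreover have "card (V // ?R) + card S = card V"
    using insert.prems forest_mono by (intro insert.IH) blast+
  ultimately show ?case using insert.hyps \<open>card (V // ?R) \<ge> 2\<close> by simp
qed

text \<open>If no edge of \<open>J - I\<close> could be added, \<open>I\<close> would connect the
  ends of every edge of \<open>J\<close>. Then \<open>I\<close> would have at most as many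
  components as \<open>J\<close>, hence at least as many edges.\<close>

lemma forest_exchange:
  assumes "finite V" "finite I" "finite J" "forest g I" "forest g J" "card I < card J"
    and ends: "\<And>e. e \<in> I \<union> J \<Longrightarrow> \<exists>a\<in>V. \<exists>b\<in>V. g e = {a, b}"
  shows "\<exists>x\<in>J - I. forest g (insert x I)"
proof (rule ccontr)
  assume no: "\<not> ?thesis"
  have "edge_conn g J \<subseteq> edge_conn g I"
  proof (rule edge_conn_subset)
    fix e assume e: "e \<in> J"
    show "g e \<times> g e \<subseteq> edge_conn g I"
    proof (cases "e \<in> I")
      case True
      then show ?thesis by (auto intro: edge_conn_edge)
    next
      case False
      obtain a b where ab: "g e = {a, b}" using ends e by blast
      then have "(a, b) \<in> edge_conn g I" using forest_insert[OF assms(4) False ab] no e False by blast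
      then show ?thesis using ab by (auto intro: edge_conn_sym)
    qed
  qed
  \<comment> \<open>Saturating under \<open>I\<close> sends the \<open>J\<close>-class of
    \<open>x\<close> to its \<open>I\<close>-class, which gives a surjection between the
    quotients.\<close>
  then have *: "edge_conn g I `` (edge_conn g J `` {x}) = edge_conn g I `` {x}" for x
    by (blast intro: edge_conn_refl dest: edge_conn_trans)
  have "V // edge_conn g I = (\<lambda>A. edge_conn g I `` A) ` (V // edge_conn g J)"
    unfolding quotient_def by (auto simp: * image_iff)
  moreover have "finite (V // edge_conn g J)" using assms(1) by (simp add: quotient_def)
  ultimately have "card (V // edge_conn g I) \<le> card (V // edge_conn g J)"
    by (simp add: card_image_le)
  moreover have "card (V // edge_conn g I) + card I = card V"
    by (rule card_edge_conn_classes) (use assms in auto)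
  moreover have "card (V // edge_conn g J) + card J = card V"
    by (rule card_edge_conn_classes) (use assms in auto)
  ultimately show False using assms(6) by simp
qed

section \<open>Cycle matroids\<close>

lemma simple_path:
  assumes "(u, v) \<in> edge_conn g T" "v \<in> V"
    and ends: "\<And>e. e \<in> T \<Longrightarrow> g e \<subseteq> V \<and> (\<exists>a b. g e = {a, b})"
  shows "\<exists>vs es. length vs = Suc (length es) \<and> vs ! 0 = u \<and> vs ! length es = v \<and>
    distinct vs \<and> distinct es \<and> set vs \<subseteq> V \<and> set es \<subseteq> T \<and>
    (\<forall>i<length es. g (es ! i) = {vs ! i, vs ! Suc i})"
  using assms(1) unfolding edge_conn_def
proof (induction rule: converse_rtrancl_induct)
  case base
  then show ?case using assms(2) by (intro exI[of _ "[v]"] exI[of _ "[]"]) auto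
next
  case (step x y)
  obtain e where e: "e \<in> T" "x \<in> g e" "y \<in> g e" using step(1) by blast
  obtain vs es where p: "length vs = Suc (length es)" "vs ! 0 = y" "vs ! length es = v"
    "distinct vs" "distinct es" "set vs \<subseteq> V" "set es \<subseteq> T"
    "\<forall>i<length es. g (es ! i) = {vs ! i, vs ! Suc i}"
    using step(3) by blast
  show ?case
  proof (cases "x \<in> set vs")
    case True
    then obtain j where j: "j < length vs" "vs ! j = x" by (auto simp: in_set_conv_nth)
    show ?thesis
      by (rule exI[of _ "drop j vs"], rule exI[of _ "drop j es"])
        (use p j in \<open>auto dest: in_set_dropD\<close>)
  next
    case False
    have "y \<in> set vs" using p(1,2) by (metis nth_mem zero_less_Suc)
    then have "x \<noteq> y" using False by blast
    then have ge: "g e = {x, y}" using e ends[OF e(1)] by auto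
    have "e \<notin> set es"
    proof
      assume "e \<in> set es"
      then obtain i where i: "i < length es" "es ! i = e" by (auto simp: in_set_conv_nth)
      then have "x \<in> {vs ! i, vs ! Suc i}" using p(8) ge by blast
      then show False using False i p(1) by auto
    qed
    moreover have "g ((e # es) ! i) = {(x # vs) ! i, (x # vs) ! Suc i}"
      if "i < length (e # es)" for i
      using that p ge by (cases i) auto
    moreover have "x \<in> V" using e ends by blast
    ultimately show ?thesis
      by (intro exI[of _ "x # vs"] exI[of _ "e # es"]) (use p e False in auto)
  qed
qed

lemma multigraph_ends:
  assumes "is_multigraph G" "e \<in> edges G"
  shows "\<exists>a\<in>verts G. \<exists>b\<in>verts G. ends G e = {a, b}"
proof -
  have s: "ends G e \<subseteq> verts G" and "card (ends G e) = 1 \<or> card (ends G e) = 2"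
    using assms unfolding is_multigraph_def by auto
  then obtain a b where "ends G e = {a, b}"
    by (metis card_1_singletonE card_2_iff insert_absorb2)
  then show ?thesis using s by auto
qed

text \<open>Without its first edge, a cycle is still a walk between the ends of that edge.\<close>

lemma cycle_not_forest:
  assumes "is_cycle G vs es" "set es \<subseteq> S"
  shows "\<not> forest (ends G) S"
proof -
  let ?n = "length es"
  let ?R = "edge_conn (ends G) (S - {es ! 0})"
  have c: "0 < ?n" "distinct es" "\<And>i. i < ?n \<Longrightarrow> ends G (es ! i) = {vs ! i, vs ! (Suc i mod ?n)}"
    using assms(1) unfolding is_cycle_def by auto
  \<comment> \<open>The start is written \<open>1 mod ?n\<close> to cover loops: for
    \<open>?n = 1\<close> the second vertex is the first one again.\<close>
  have "(vs ! (1 mod ?n), vs ! (Suc i mod ?n)) \<in> ?R" if "i < ?n" for i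
    using that
  proof (induction i)
    case 0
    then show ?case by simp
  next
    case (Suc i)
    have "es ! Suc i \<in> S - {es ! 0}"
      using Suc.prems c(1,2) assms(2) nth_eq_iff_index_eq[of es "Suc i" 0] by auto
    then have "(vs ! Suc i, vs ! (Suc (Suc i) mod ?n)) \<in> ?R"
      using c(3)[OF Suc.prems] by (auto intro: edge_conn_edge)
    then show ?case using Suc edge_conn_trans by fastforce
  qed
  from this[of "?n - 1"] have "(vs ! (1 mod ?n), vs ! 0) \<in> ?R" using c(1) by simp
  moreover have "ends G (es ! 0) = {vs ! (1 mod ?n), vs ! 0}" using c(3)[of 0] c(1) by auto
  moreover have "es ! 0 \<in> S" using c(1) assms(2) by auto
  ultimately show ?thesis unfolding forest_def by blast
qed

text \<open>An edge that is no bridge closes up a simple path that avoids it.\<close>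

lemma not_forest_cycle:
  assumes G: "is_multigraph G" and S: "S \<subseteq> edges G" and nf: "\<not> forest (ends G) S"
  shows "\<exists>vs es. is_cycle G vs es \<and> set es \<subseteq> S"
proof -
  obtain e u v where e: "e \<in> S" "ends G e = {u, v}" "(u, v) \<in> edge_conn (ends G) (S - {e})"
    using nf unfolding forest_def by blast
  have uv: "v \<in> verts G" using multigraph_ends[OF G, of e] S e by (auto simp: doubleton_eq_iff)
  have ends: "ends G f \<subseteq> verts G \<and> (\<exists>a b. ends G f = {a, b})" if "f \<in> S - {e}" for f
  proof -
    have "f \<in> edges G" using S that by blast
    then show ?thesis using multigraph_ends[OF G, of f] by fastforce
  qed
  obtain vs es where p: "length vs = Suc (length es)" "vs ! 0 = u" "vs ! length es = v"
    "distinct vs" "distinct es" "set vs \<subseteq> verts G" "set es \<subseteq> S - {e}"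
    "\<forall>i<length es. ends G (es ! i) = {vs ! i, vs ! Suc i}"
    using simple_path[OF e(3) uv] ends by blast
  \<comment> \<open>At \<open>i = length es\<close> the successor index wraps to 0, so the closing
    edge \<open>e\<close> joins \<open>v\<close> back to \<open>u\<close>.\<close>
  have "ends G ((es @ [e]) ! i) = {vs ! i, vs ! (Suc i mod length (es @ [e]))}"
    if "i < length (es @ [e])" for i
    using that p e(2) by (cases "i = length es") (auto simp: nth_append)
  then have "is_cycle G vs (es @ [e])"
    unfolding is_cycle_def using p S e by auto
  then show ?thesis using p e by (intro exI[of _ vs] exI[of _ "es @ [e]"]) auto
qed

text \<open>All later reasoning about independence uses this description by bridges in place of
  explicit cycles.\<close>

lemma indep_cycle_matroid:
  assumes "is_multigraph G"
  shows "S \<in> indep (cycle_matroid G) \<longleftrightarrow> S \<subseteq> edges G \<and> forest (ends G) S"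
  using cycle_not_forest[of G _ _ S] not_forest_cycle[OF assms, of S]
  unfolding cycle_matroid_def by simp blast

lemma is_matroid_cycle_matroid:
  assumes G: "is_multigraph G"
  shows "is_matroid (cycle_matroid G)"
proof -
  have fin: "finite (verts G)" "finite (edges G)" using G by (auto simp: is_multigraph_def)
  have "\<exists>x\<in>J - I. insert x I \<in> indep (cycle_matroid G)"
    if I: "I \<in> indep (cycle_matroid G)" and J: "J \<in> indep (cycle_matroid G)"
      and "card I < card J" for I J
  proof -
    have sub: "I \<subseteq> edges G" "J \<subseteq> edges G"
      using I J indep_cycle_matroid[OF G] by auto
    then have "\<exists>x\<in>J - I. forest (ends G) (insert x I)"
      using I J indep_cycle_matroid[OF G] that(3) fin multigraph_ends[OF G]
      by (intro forest_exchange[of "verts G"]) (auto intro: finite_subset)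
    then show ?thesis using sub by (auto simp: indep_cycle_matroid[OF G])
  qed
  moreover have "{} \<in> indep (cycle_matroid G)"
    by (simp add: indep_cycle_matroid[OF G] forest_def)
  moreover have "I \<in> indep (cycle_matroid G)" if "J \<in> indep (cycle_matroid G)" "I \<subseteq> J" for I J
    using that forest_mono[of "ends G" J I] by (auto simp: indep_cycle_matroid[OF G])
  moreover have "indep (cycle_matroid G) \<subseteq> Pow (ground (cycle_matroid G))"
    by (auto simp: cycle_matroid_def)
  moreover have "finite (ground (cycle_matroid G))" using fin by (simp add: cycle_matroid_def)
  ultimately show ?thesis unfolding is_matroid_def by blast
qed

section \<open>Contracting a forest\<close>

lemma partition_on_cell_unique:
  assumes "partition_on V P" "A \<in> P" "B \<in> P" "x \<in> A" "x \<in> B"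
  shows "A = B"
  using partition_onD2[OF assms(1)] assms(2-5) unfolding disjoint_def by blast

lemma partition_on_cell_obtain:
  assumes "partition_on V P" "x \<in> V"
  obtains A where "A \<in> P" "x \<in> A"
  using partition_onD1[OF assms(1)] assms(2) by blast

lemma ends_cell_graph:
  assumes "partition_on (verts G) P" "ends G e = {a, b}" "A \<in> P" "a \<in> A" "B \<in> P" "b \<in> B"
  shows "ends (cell_graph G P) e = {A, B}"
proof -
  have "a \<in> D \<longleftrightarrow> D = A" "b \<in> D \<longleftrightarrow> D = B" if "D \<in> P" for D
    using partition_on_cell_unique[OF assms(1)] assms(3-6) that by metis+
  then show ?thesis using assms(2,3,5) by (auto simp: cell_graph_def)
qed

lemma cell_graph_edge_cells:
  assumes G: "is_multigraph G" and P: "partition_on (verts G) P" and e: "e \<in> edges G"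
  obtains a b A B where "ends G e = {a, b}" "A \<in> P" "a \<in> A" "B \<in> P" "b \<in> B"
    "ends (cell_graph G P) e = {A, B}"
proof -
  obtain a b where ab: "a \<in> verts G" "b \<in> verts G" "ends G e = {a, b}"
    using multigraph_ends[OF G e] by blast
  obtain A where A: "A \<in> P" "a \<in> A" using partition_on_cell_obtain[OF P ab(1)] .
  obtain B where B: "B \<in> P" "b \<in> B" using partition_on_cell_obtain[OF P ab(2)] .
  show ?thesis using that[OF ab(3) A B ends_cell_graph[OF P ab(3) A B]] .
qed

lemma is_multigraph_cell_graph:
  assumes G: "is_multigraph G" and P: "partition_on (verts G) P"
  shows "is_multigraph (cell_graph G P)"
proof -
  have "finite P" "finite (edges G)"
    using G P finite_elements by (auto simp: is_multigraph_def)
  moreover have "ends (cell_graph G P) e \<subseteq> P \<and> card (ends (cell_graph G P) e) \<in> {1, 2}"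
    if e: "e \<in> edges G" for e
  proof -
    obtain A B where "A \<in> P" "B \<in> P" "ends (cell_graph G P) e = {A, B}"
      using cell_graph_edge_cells[OF G P e] .
    then show ?thesis by (cases "A = B") auto
  qed
  ultimately show ?thesis by (simp add: is_multigraph_def cell_graph_def)
qed

text \<open>
  \<open>\<phi>\<close> maps the vertices of \<open>G\<close> onto those of a graph with incidence function \<open>g\<close> in which \<open>G\<close>
  sits along \<open>\<iota>\<close>, and the cells of \<open>P\<close> are the preimages of the components of the forest \<open>C\<close>.
\<close>

locale cells_by_forest =
  fixes G :: "('v, 'e) multigraph" and P :: "'v set set"
    and g :: "'f \<Rightarrow> 'w set" and C :: "'f set" and \<iota> :: "'e \<Rightarrow> 'f" and \<phi> :: "'v \<Rightarrow> 'w"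
  assumes multigraph: "is_multigraph G"
    and partition: "partition_on (verts G) P"
    and ends_image: "e \<in> edges G \<Longrightarrow> g (\<iota> e) = \<phi> ` ends G e"
    and inj: "inj_on \<iota> (edges G)"
    and disj: "\<iota> ` edges G \<inter> C = {}"
    and cells: "u \<in> verts G \<Longrightarrow> v \<in> verts G \<Longrightarrow>
      (\<exists>A\<in>P. u \<in> A \<and> v \<in> A) \<longleftrightarrow> (\<phi> u, \<phi> v) \<in> edge_conn g C"
    and ends_forest: "c \<in> C \<Longrightarrow> g c \<subseteq> \<phi> ` verts G"
    and forest: "forest g C"
begin

section \<open>Connectivity and acyclicity before and after contraction\<close>

lemma cell_subset: "A \<in> P \<Longrightarrow> A \<subseteq> verts G"
  using partition_onD1[OF partition] by blast

lemma same_cell: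
  assumes "A \<in> P" "u \<in> A" "B \<in> P" "v \<in> B" "(\<phi> u, \<phi> v) \<in> edge_conn g C"
  shows "A = B"
proof -
  have "u \<in> verts G" "v \<in> verts G" using assms cell_subset by blast+
  then obtain D where "D \<in> P" "u \<in> D" "v \<in> D" using cells assms(5) by blast
  then show ?thesis using partition_on_cell_unique[OF partition] assms by blast
qed

lemma conn_cell:
  assumes "A \<in> P" "u \<in> A" "v \<in> A"
  shows "(\<phi> u, \<phi> v) \<in> edge_conn g (T \<union> C)"
proof -
  have "(\<phi> u, \<phi> v) \<in> edge_conn g C" using cells[of u v] assms cell_subset by blast
  then show ?thesis using edge_conn_mono[of C "T \<union> C" g] by blast
qed

text \<open>A walk through cells lifts once the gaps inside each cell are bridged by
  \<open>C\<close>. Conversely, steps along \<open>C\<close> stay inside a cell and steps along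
  \<open>\<iota> e\<close> are edges between cells.\<close>

lemma edge_conn_cell_graph:
  assumes S: "S \<subseteq> edges G" and A: "A \<in> P" "u \<in> A" and B: "B \<in> P" "v \<in> B"
  shows "(A, B) \<in> edge_conn (ends (cell_graph G P)) S \<longleftrightarrow>
    (\<phi> u, \<phi> v) \<in> edge_conn g (\<iota> ` S \<union> C)"
proof
  assume "(A, B) \<in> edge_conn (ends (cell_graph G P)) S"
  then show "(\<phi> u, \<phi> v) \<in> edge_conn g (\<iota> ` S \<union> C)"
    using B unfolding edge_conn_def[of "ends (cell_graph G P)"]
  proof (induction arbitrary: v rule: rtrancl_induct)
    case base
    then show ?case using conn_cell A by blast
  next
    case (step B D)
    obtain e where e: "e \<in> S" "B \<in> ends (cell_graph G P) e" "D \<in> ends (cell_graph G P) e"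
      using step(2) by blast
    then obtain b d where bd: "B \<in> P" "b \<in> B" "b \<in> ends G e" "d \<in> D" "d \<in> ends G e"
      unfolding cell_graph_def by auto
    have "\<phi> b \<in> g (\<iota> e)" "\<phi> d \<in> g (\<iota> e)" using ends_image[of e] e(1) S bd by auto
    then have "(\<phi> b, \<phi> d) \<in> edge_conn g (\<iota> ` S \<union> C)"
      using e(1) by (intro edge_conn_edge[of "\<iota> e"]) auto
    moreover have "(\<phi> u, \<phi> b) \<in> edge_conn g (\<iota> ` S \<union> C)" using step.IH bd by blast
    moreover have "(\<phi> d, \<phi> v) \<in> edge_conn g (\<iota> ` S \<union> C)" using conn_cell step.prems bd by blast
    ultimately show ?case by (meson edge_conn_trans)
  qed
next
  let ?R = "edge_conn (ends (cell_graph G P)) S"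
  \<comment> \<open>The walk runs in the target of \<open>\<phi>\<close>, so the claim is made for
    every preimage \<open>v\<close> of its current endpoint and the cell \<open>B\<close> of
    \<open>v\<close>.\<close>
  have "(A, B) \<in> ?R" if "(\<phi> u, w) \<in> edge_conn g (\<iota> ` S \<union> C)" "\<phi> v = w" "B \<in> P" "v \<in> B" for w v B
    using that unfolding edge_conn_def[of g]
  proof (induction arbitrary: v B rule: rtrancl_induct)
    case base
    \<comment> \<open>The map \<open>\<phi>\<close> may identify \<open>u\<close> and
      \<open>v\<close>; by \<open>cells\<close> it does so only within one cell.\<close>
    then have "(\<phi> u, \<phi> v) \<in> edge_conn g C" by simp
    then show ?case using same_cell[OF A base(2,3)] by simp
  next
    case (step w w')
    obtain f where f: "f \<in> \<iota> ` S \<union> C" "w \<in> g f" "w' \<in> g f" using step(2) by blast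
    show ?case
    proof (cases "f \<in> C")
      case True
      \<comment> \<open>An intermediate vertex reached along \<open>C\<close> has a preimage by
        \<open>ends_forest\<close>, so the induction hypothesis applies to it.\<close>
      then obtain b where b: "b \<in> verts G" "\<phi> b = w" using f ends_forest by blast
      then obtain D where D: "D \<in> P" "b \<in> D" using partition_on_cell_obtain[OF partition] by blast
      have "(\<phi> b, \<phi> v) \<in> edge_conn g C" using True f b step.prems(1) edge_conn_edge by fast
      then have "D = B" using same_cell D step.prems by blast
      then show ?thesis using step.IH[OF b(2) D] by simp
    next
      case False
      then obtain e where e: "e \<in> S" "f = \<iota> e" using f by blast
      then have "e \<in> edges G" using S by blast
      then have sub: "ends G e \<subseteq> verts G" and "g f = \<phi> ` ends G e"
        using ends_image e multigraph by (auto simp: is_multigraph_def)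
      then obtain b d where bd: "b \<in> ends G e" "\<phi> b = w" "d \<in> ends G e" "\<phi> d = w'"
        using f(2,3) by auto
      obtain D where D: "D \<in> P" "b \<in> D"
        using partition_on_cell_obtain[OF partition, of b] sub bd by blast
      obtain F where F: "F \<in> P" "d \<in> F"
        using partition_on_cell_obtain[OF partition, of d] sub bd by blast
      have "F = B" using same_cell[OF F step.prems(2,3)] bd step.prems(1) by simp
      moreover have "(D, F) \<in> ?R"
        using e(1) D F bd by (intro edge_conn_edge[of e]) (auto simp: cell_graph_def)
      moreover have "(A, D) \<in> ?R" using step.IH[OF bd(2) D] .
      ultimately show ?thesis by (meson edge_conn_trans)
    qed
  qed
  moreover assume "(\<phi> u, \<phi> v) \<in> edge_conn g (\<iota> ` S \<union> C)"
  ultimately show "(A, B) \<in> ?R" using B by blast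
qed

text \<open>Bridges of the cell graph correspond to bridges among the edges \<open>\<iota> e\<close>
  in the presence of \<open>C\<close>. The edges of \<open>C\<close> themselves are handled by
  \<open>forest_Un\<close>, as \<open>C\<close> is a forest.\<close>

lemma forest_cell_graph:
  assumes S: "S \<subseteq> edges G"
  shows "forest (ends (cell_graph G P)) S \<longleftrightarrow> forest g (\<iota> ` S \<union> C)"
proof
  \<comment> \<open>Injectivity of \<open>\<iota>\<close> and disjointness from \<open>C\<close> let
    the removal of an edge commute with \<open>\<iota>\<close>.\<close>
  have eq: "\<iota> ` S \<union> C - {\<iota> e} = \<iota> ` (S - {e}) \<union> C" "\<iota> ` S - {\<iota> e} = \<iota> ` (S - {e})"
    if "e \<in> S" for e
  proof -
    have "\<iota> ` (S - {e}) = \<iota> ` S - \<iota> ` {e}"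
      by (rule inj_on_image_set_diff[OF inj]) (use S that in auto)
    then show diff: "\<iota> ` S - {\<iota> e} = \<iota> ` (S - {e})" by simp
    have "\<iota> e \<notin> C" using disj S that by blast
    then show "\<iota> ` S \<union> C - {\<iota> e} = \<iota> ` (S - {e}) \<union> C" by (simp add: Un_Diff diff)
  qed
  {
    assume *: "forest g (\<iota> ` S \<union> C)"
    show "forest (ends (cell_graph G P)) S"
      unfolding forest_def
    proof (intro ballI allI impI notI)
      fix e A B
      assume e: "e \<in> S" "ends (cell_graph G P) e = {A, B}"
        and conn: "(A, B) \<in> edge_conn (ends (cell_graph G P)) (S - {e})"
      have eG: "e \<in> edges G" using e S by blast
      obtain a b A' B' where "ends G e = {a, b}" "A' \<in> P" "a \<in> A'" "B' \<in> P" "b \<in> B'"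
        "ends (cell_graph G P) e = {A', B'}"
        using cell_graph_edge_cells[OF multigraph partition eG] .
      then obtain a b where ab: "ends G e = {a, b}" "A \<in> P" "a \<in> A" "B \<in> P" "b \<in> B"
        using e(2) by (auto simp: doubleton_eq_iff)
      then have "(\<phi> a, \<phi> b) \<in> edge_conn g (\<iota> ` S \<union> C - {\<iota> e})"
        using edge_conn_cell_graph[of "S - {e}" A a B b] conn S eq(1)[OF e(1)] by auto
      moreover have "g (\<iota> e) = {\<phi> a, \<phi> b}" using ends_image[OF eG] ab(1) by simp
      ultimately show False using * e(1) unfolding forest_def by blast
    qed
  next
    assume *: "forest (ends (cell_graph G P)) S"
    show "forest g (\<iota> ` S \<union> C)"
    proof (rule forest_Un[OF forest])
      show "finite (\<iota> ` S)"
        using S multigraph by (auto simp: is_multigraph_def intro: finite_subset)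
      show "\<iota> ` S \<inter> C = {}" using S disj by blast
      show "\<exists>a b. g f = {a, b}" if "f \<in> \<iota> ` S" for f
        using that S ends_image multigraph_ends[OF multigraph] by fastforce
      fix f x y assume f: "f \<in> \<iota> ` S" "g f = {x, y}"
      then obtain e where e: "e \<in> S" "f = \<iota> e" by blast
      then have eG: "e \<in> edges G" using S by blast
      obtain a b A B where ab: "ends G e = {a, b}" "A \<in> P" "a \<in> A" "B \<in> P" "b \<in> B"
        "ends (cell_graph G P) e = {A, B}"
        using cell_graph_edge_cells[OF multigraph partition eG] .
      have "(A, B) \<notin> edge_conn (ends (cell_graph G P)) (S - {e})"
        using * e ab(6) unfolding forest_def by blast
      then have "(\<phi> a, \<phi> b) \<notin> edge_conn g (C \<union> (\<iota> ` S - {f}))"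
        using edge_conn_cell_graph[of "S - {e}" A a B b] ab S eq(2)[OF e(1)] e(2)
        by (auto simp: Un_commute)
      moreover have "{x, y} = {\<phi> a, \<phi> b}" using f(2) ends_image[OF eG] ab(1) e(2) by simp
      ultimately show "(x, y) \<notin> edge_conn g (C \<union> (\<iota> ` S - {f}))"
        by (metis doubleton_eq_iff edge_conn_sym)
    qed
  }
qed

lemma indep_partition_matroid:
  "S \<in> indep (partition_matroid G P) \<longleftrightarrow> S \<subseteq> edges G \<and> forest g (\<iota> ` S \<union> C)"
  using forest_cell_graph[of S]
  unfolding partition_matroid_def
    indep_cycle_matroid[OF is_multigraph_cell_graph[OF multigraph partition]]
  by (auto simp: cell_graph_def)

end

text \<open>An independent set is its own only basis, which removes the quantifier over bases from
  \<open>contract\<close>.\<close>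

lemma delete_contract_indep:
  assumes "C \<in> indep M"
  shows "delete (contract M C) D = \<lparr>ground = ground M - C - D,
    indep = {I. I \<subseteq> ground M - C - D \<and> I \<union> C \<in> indep M}\<rparr>"
proof -
  have "basis_of M C B \<longleftrightarrow> B = C" for B
    using assms by (auto simp: basis_of_def)
  then show ?thesis by (auto simp: delete_def contract_def)
qed

text \<open>Common core of both directions: contracting \<open>Y\<close> turns the components of
  this forest into the cells of \<open>P\<close>, and deleting \<open>Z\<close> leaves just the
  edges of \<open>G\<close>.\<close>

lemma relabel_partition_matroid_eq_minor:
  assumes H: "is_multigraph H" "edges H = edges G <+> X" "forest (ends H) (Inr ` X)"
    and X: "X = Y \<union> Z"
    and cbf: "cells_by_forest G P (ends H) (Inr ` Y) Inl \<phi>"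
  shows "relabel Inl (partition_matroid G P) =
    delete (contract (cycle_matroid H) (Inr ` Y)) (Inr ` Z)"
proof -
  interpret cells_by_forest G P "ends H" "Inr ` Y" Inl \<phi> by (rule cbf)
  have "Inr ` Y \<in> indep (cycle_matroid H)"
    using H X forest by (auto simp: indep_cycle_matroid[OF H(1)])
  note minor = delete_contract_indep[OF this, of "Inr ` Z"]
  have gr: "ground (cycle_matroid H) - Inr ` Y - Inr ` Z = Inl ` edges G"
    using H(2) X by (auto simp: cycle_matroid_def Plus_def)
  have "(`) Inl ` indep (partition_matroid G P) =
    {I. I \<subseteq> Inl ` edges G \<and> I \<union> Inr ` Y \<in> indep (cycle_matroid H)}"
    (is "?L = ?R")
  proof (intro equalityI subsetI)
    fix I assume "I \<in> ?L"
    then obtain S where "I = Inl ` S" "S \<subseteq> edges G" "forest (ends H) (Inl ` S \<union> Inr ` Y)"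
      using indep_partition_matroid by auto
    then show "I \<in> ?R" using H(2) X by (auto simp: indep_cycle_matroid[OF H(1)])
  next
    fix I assume I: "I \<in> ?R"
    then obtain S where S: "I = Inl ` S" "S \<subseteq> edges G" by (auto simp: subset_image_iff)
    then have "S \<in> indep (partition_matroid G P)"
      using I by (simp add: indep_partition_matroid indep_cycle_matroid[OF H(1)])
    then show "I \<in> ?L" using S by blast
  qed
  moreover have "ground (partition_matroid G P) = edges G"
    by (simp add: partition_matroid_def cycle_matroid_def cell_graph_def)
  ultimately show ?thesis unfolding minor gr by (simp add: relabel_def)
qed

text \<open>Cancels \<open>Inl\<close> in the equations that define a major.\<close>

lemma relabel_eq_iff:
  assumes "inj f"
  shows "relabel f M = relabel f N \<longleftrightarrow> M = N"
proof -
  have "inj ((`) f)" using inj_image_eq_iff[OF assms] by (auto intro: injI)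
  then show ?thesis
    unfolding relabel_def matroid.simps matroid.ext_inject
    using assms by (auto simp: inj_image_eq_iff intro: matroid.equality)
qed

section \<open>From a graphic major to a graphic flag\<close>

lemma quotient_edge_conn_cells:
  assumes "u \<in> V"
  shows "(\<exists>A\<in>V // edge_conn g S. u \<in> A \<and> v \<in> A) \<longleftrightarrow> (u, v) \<in> edge_conn g S"
proof
  assume "\<exists>A\<in>V // edge_conn g S. u \<in> A \<and> v \<in> A"
  then obtain x where "(x, u) \<in> edge_conn g S" "(x, v) \<in> edge_conn g S"
    by (auto elim!: quotientE)
  then show "(u, v) \<in> edge_conn g S" by (meson edge_conn_sym edge_conn_trans)
next
  assume "(u, v) \<in> edge_conn g S"
  then show "\<exists>A\<in>V // edge_conn g S. u \<in> A \<and> v \<in> A"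
    using assms by (intro bexI[of _ "edge_conn g S `` {u}"]) (auto simp: quotientI)
qed

lemma partition_on_quotient_edge_conn:
  assumes "\<And>e. e \<in> S \<Longrightarrow> g e \<subseteq> V"
  shows "partition_on V (V // edge_conn g S)"
proof (rule partition_onI)
  show "\<Union>(V // edge_conn g S) = V"
  proof (intro equalityI subsetI)
    fix y assume "y \<in> \<Union>(V // edge_conn g S)"
    then obtain x where "x \<in> V" "(x, y) \<in> edge_conn g S" by (auto elim!: quotientE)
    then show "y \<in> V" using edge_conn_closed[of x y g S V] assms by blast
  next
    fix y assume "y \<in> V"
    then show "y \<in> \<Union>(V // edge_conn g S)" by (auto simp: quotient_def intro: edge_conn_refl)
  qed
  show "disjnt p q" if "p \<in> V // edge_conn g S" "q \<in> V // edge_conn g S" "p \<noteq> q" for p q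
    using that quotient_disj[OF equiv_edge_conn[of g S], of p q]
    by (auto simp: disjnt_def quotient_def)
  show "{} \<notin> V // edge_conn g S"
  proof
    assume "{} \<in> V // edge_conn g S"
    then obtain x where "edge_conn g S `` {x} = {}" by (auto elim!: quotientE)
    moreover have "x \<in> edge_conn g S `` {x}" by simp
    ultimately show False by blast
  qed
qed

lemma graphic_flag_matroid_if_graphic_major:
  fixes Q :: "('a + nat) matroid"
  assumes flag: "flag_matroid E Ms" and maj: "major E Ms Q" and gr: "graphic_matroid Q"
  shows "graphic_flag_matroid E Ms"
proof -
  obtain H :: "(nat, 'a + nat) multigraph" where H: "is_multigraph H" "Q = cycle_matroid H"
    using gr by (auto simp: graphic_matroid_def)
  obtain X Xs where X: "ground Q = E <+> X" "Inr ` X \<in> indep Q"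
    "length Xs = length Ms - 1" "distinct Xs" "partition_on X (set Xs)"
    and minor: "\<And>i. i < length Ms \<Longrightarrow> relabel Inl (Ms ! i) =
      delete (contract Q (Inr ` \<Union>(set (drop i Xs)))) (Inr ` \<Union>(set (take i Xs)))"
    using maj unfolding major_def by blast
  have eH: "edges H = E <+> X" using X(1) H(2) by (simp add: cycle_matroid_def)
  have fX: "forest (ends H) (Inr ` X)" using X(2) H by (simp add: indep_cycle_matroid)
  \<comment> \<open>\<open>G\<close> is \<open>H\<close> with the edges of \<open>X\<close> deleted
    and all vertices kept.\<close>
  define G where "G = \<lparr>verts = verts H, edges = E, ends = (\<lambda>e. ends H (Inl e))\<rparr>"
  have G: "is_multigraph G"
    using H(1) eH flag by (auto simp: is_multigraph_def G_def flag_matroid_def)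
  have split: "X = \<Union>(set (drop i Xs)) \<union> \<Union>(set (take i Xs))" for i
    using partition_onD1[OF X(5)] by (metis Sup_union_distrib append_take_drop_id set_append sup_commute)
  define C :: "nat \<Rightarrow> ('a + nat) set" where "C i = Inr ` \<Union>(set (drop i Xs))" for i
  define P where "P i = verts H // edge_conn (ends H) (C i)" for i
  have CX: "C i \<subseteq> Inr ` X" for i using split[of i] by (auto simp: C_def)
  have endsX: "ends H e \<subseteq> verts H" if "e \<in> Inr ` X" for e
    using H(1) eH that by (auto simp: is_multigraph_def)
  have part: "partition_on (verts H) (P i)" for i
    unfolding P_def by (rule partition_on_quotient_edge_conn) (use CX endsX in blast)
  have "(relabel Inl (partition_matroid G (P i)) :: ('a + nat) matroid) = relabel Inl (Ms ! i)" if "i < length Ms" for i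
    unfolding minor[OF that] H(2)
  proof (rule relabel_partition_matroid_eq_minor[OF H(1) _ fX split])
    show "edges H = edges G <+> X" using eH by (simp add: G_def)
    \<comment> \<open>\<open>G\<close> and \<open>H\<close> have the same vertices, so
      \<open>\<phi>\<close> is the identity.\<close>
    show "cells_by_forest G (P i) (ends H) (Inr ` \<Union>(set (drop i Xs))) Inl id"
    proof
      show "u \<in> verts G \<Longrightarrow> v \<in> verts G \<Longrightarrow> (\<exists>A\<in>P i. u \<in> A \<and> v \<in> A) \<longleftrightarrow>
        (id u, id v) \<in> edge_conn (ends H) (Inr ` \<Union>(set (drop i Xs)))" for u v
        unfolding P_def C_def id_apply by (rule quotient_edge_conn_cells) (simp add: G_def)
      show "c \<in> Inr ` \<Union>(set (drop i Xs)) \<Longrightarrow> ends H c \<subseteq> id ` verts G" for c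
        using CX[of i] endsX[of c] by (auto simp: G_def C_def)
      show "forest (ends H) (Inr ` \<Union>(set (drop i Xs)))"
        using CX[of i] fX forest_mono by (auto simp: C_def)
    qed (use G part in \<open>auto simp: G_def\<close>)
  qed
  then have "Ms = map (partition_matroid G) (map P [0..<length Ms])"
    by (intro nth_equalityI) (auto simp: relabel_eq_iff)
  moreover have "successively (\<lambda>P Q. refines (verts G) Q P \<and> Q \<noteq> P) (map P [0..<length Ms])"
    unfolding successively_conv_nth
  proof (intro allI impI)
    fix i assume "Suc i < length (map P [0..<length Ms])"
    then have i: "Suc i < length Ms" "i < length Xs" using X(3) by auto
    have drop: "drop i Xs = Xs ! i # drop (Suc i) Xs" using i by (simp add: Cons_nth_drop_Suc)
    \<comment> \<open>One block fewer is contracted at each step, so the components get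
      smaller.\<close>
    have sub: "C (Suc i) \<subseteq> C i" unfolding C_def drop by auto
    have "refines (verts H) (P (Suc i)) (P i)"
      unfolding refines_def
    proof (intro conjI part ballI)
      fix A assume "A \<in> P (Suc i)"
      then obtain x where "x \<in> verts H" "A = edge_conn (ends H) (C (Suc i)) `` {x}"
        unfolding P_def by (auto elim: quotientE)
      then show "\<exists>B\<in>P i. A \<subseteq> B"
        using edge_conn_mono[OF sub, of "ends H"]
        by (intro bexI[of _ "edge_conn (ends H) (C i) `` {x}"]) (auto simp: P_def quotientI)
    qed
    moreover have "P (Suc i) \<noteq> P i"
    proof
      assume eq: "P (Suc i) = P i"
      have "Xs ! i \<in> set Xs" using i by simp
      moreover from this have "Xs ! i \<noteq> {}" using partition_onD3[OF X(5)] by metis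
      ultimately obtain x where x: "x \<in> Xs ! i" "x \<in> X"
        using partition_onD1[OF X(5)] by blast
      \<comment> \<open>By disjointness, a later block containing \<open>x\<close> would be
        \<open>Xs ! i\<close> again, a repetition which \<open>distinct Xs\<close> forbids.\<close>
      have "x \<notin> \<Union>(set (drop (Suc i) Xs))"
      proof
        assume "x \<in> \<Union>(set (drop (Suc i) Xs))"
        then obtain Y where Y: "Y \<in> set (drop (Suc i) Xs)" "x \<in> Y" by blast
        then have "Y = Xs ! i"
          using partition_on_cell_unique[OF X(5), of Y "Xs ! i" x] x i
          by (meson in_set_dropD nth_mem)
        then show False using Y(1) X(4) drop by (metis distinct.simps(2) distinct_drop)
      qed
      then have sub': "C (Suc i) \<subseteq> Inr ` X - {Inr x}" using CX[of "Suc i"] unfolding C_def by blast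
      have xi: "Inr x \<in> C i" "Inr x \<in> edges H" using x drop eH by (auto simp: C_def)
      obtain a b where ab: "a \<in> verts H" "b \<in> verts H" "ends H (Inr x) = {a, b}"
        using multigraph_ends[OF H(1) xi(2)] by blast
      have "(a, b) \<in> edge_conn (ends H) (C i)" using xi(1) ab by (auto intro: edge_conn_edge)
      \<comment> \<open>With equal partitions the ends of \<open>x\<close> would be joined by edges
        of \<open>X\<close> other than \<open>x\<close>, although \<open>X\<close> is a
        forest.\<close>
      then have "(a, b) \<in> edge_conn (ends H) (C (Suc i))"
        using quotient_edge_conn_cells[OF ab(1)] eq unfolding P_def by metis
      then show False
        using fX x(2) ab(3) edge_conn_mono[OF sub', of "ends H"] unfolding forest_def by blast
    qed
    ultimately show "refines (verts G) (map P [0..<length Ms] ! Suc i) (map P [0..<length Ms] ! i)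
        \<and> map P [0..<length Ms] ! Suc i \<noteq> map P [0..<length Ms] ! i"
      using i by (simp add: G_def del: upt_Suc)
  qed
  ultimately show ?thesis
    unfolding graphic_flag_matroid_def using G part
    by (intro exI[of _ G] exI[of _ "map P [0..<length Ms]"]) (auto simp: G_def)
qed

section \<open>From a graphic flag to a graphic major\<close>

text \<open>Labels are inserted in increasing order. Earlier edges have only ends below
  \<open>r\<close>, so \<open>r\<close> is isolated when its edge arrives.\<close>

lemma parent_edges_forest:
  fixes X :: "'b :: linorder set"
  assumes "finite X" "\<And>r. r \<in> X \<Longrightarrow> g (h r) = {r, par r} \<and> par r < r"
  shows "forest g (h ` X)"
  using assms
proof (induction X rule: finite_linorder_max_induct)
  case empty
  then show ?case by (simp add: forest_def)
next
  case (insert r X)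
  have away: "r \<notin> g f" if "f \<in> h ` X" for f
    using that insert.prems insert.hyps(2) by fastforce
  have "(r, y) \<in> edge_conn g (h ` X) \<Longrightarrow> y = r" for y
    unfolding edge_conn_def
    by (induction rule: rtrancl_induct) (use away in auto)
  moreover have "g (h r) = {r, par r}" "par r \<noteq> r" using insert.prems[of r] by auto
  \<comment> \<open>The edge \<open>h r\<close> is new because it has \<open>r\<close> as an
    end.\<close>
  moreover have "h r \<notin> h ` X" using away calculation(2) by blast
  moreover have "forest g (h ` X)" using insert by blast
  ultimately show ?case using forest_insert[of g "h ` X" "h r" r "par r"] by auto
qed

text \<open>For \<open>f = moved\<close>, whose last value is empty, this says that the blocks from
  \<open>i\<close> on make up \<open>moved i\<close>.\<close>

lemma antimono_telescope:
  fixes f :: "nat \<Rightarrow> 'b set"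
  assumes "\<And>i j. i \<le> j \<Longrightarrow> j \<le> n \<Longrightarrow> f j \<subseteq> f i" "i \<le> n"
  shows "(\<Union>j\<in>{i..<n}. f j - f (Suc j)) = f i - f n"
  using assms
proof (induction n)
  case 0
  then show ?case by simp
next
  case (Suc n)
  show ?case
  proof (cases "i = Suc n")
    case True
    then show ?thesis by simp
  next
    case False
    then have "i \<le> n" using Suc.prems by simp
    moreover have "(\<Union>j\<in>{i..<n}. f j - f (Suc j)) = f i - f n"
      using Suc.prems \<open>i \<le> n\<close> by (intro Suc.IH) auto
    moreover have "f n \<subseteq> f i" "f (Suc n) \<subseteq> f n" using Suc.prems \<open>i \<le> n\<close> by auto
    ultimately show ?thesis by (auto simp: atLeastLessThanSuc)
  qed
qed

text \<open>\<open>\<rho> i v\<close> stands for the least vertex of the cell of \<open>v\<close> in the \<open>i\<close>-th partition of the chain.\<close>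

locale nested_minima =
  fixes V :: "nat set" and k :: nat and \<rho> :: "nat \<Rightarrow> nat \<Rightarrow> nat"
  assumes finite_V: "finite V"
    and min_in: "i \<le> k \<Longrightarrow> v \<in> V \<Longrightarrow> \<rho> i v \<in> V"
    and min_le: "i \<le> k \<Longrightarrow> v \<in> V \<Longrightarrow> \<rho> i v \<le> v"
    and min_idem: "i \<le> k \<Longrightarrow> v \<in> V \<Longrightarrow> \<rho> i (\<rho> i v) = \<rho> i v"
    and coarsen: "i \<le> j \<Longrightarrow> j \<le> k \<Longrightarrow> u \<in> V \<Longrightarrow> v \<in> V \<Longrightarrow> \<rho> j u = \<rho> j v \<Longrightarrow> \<rho> i u = \<rho> i v"
begin

lemma min_coarse_fine: "i \<le> j \<Longrightarrow> j \<le> k \<Longrightarrow> v \<in> V \<Longrightarrow> \<rho> i (\<rho> j v) = \<rho> i v"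
  by (rule coarsen[of i j]) (auto intro: min_in min_idem)

text \<open>The \<open>j\<close>-minimum of \<open>\<rho> i v\<close> lies in the same
  \<open>i\<close>-cell, so it cannot be below the minimum of that cell.\<close>

lemma min_fine_coarse:
  assumes "i \<le> j" "j \<le> k" "v \<in> V"
  shows "\<rho> j (\<rho> i v) = \<rho> i v"
proof (rule antisym)
  have i: "i \<le> k" "\<rho> i v \<in> V" using assms min_in by auto
  then show "\<rho> j (\<rho> i v) \<le> \<rho> i v" using assms min_le by blast
  have "\<rho> i (\<rho> j (\<rho> i v)) = \<rho> i v"
    using assms i by (simp add: min_coarse_fine min_idem)
  then show "\<rho> i v \<le> \<rho> j (\<rho> i v)"
    using min_le[of i "\<rho> j (\<rho> i v)"] assms i min_in by auto
qed

text \<open>Index \<open>k\<close> belongs to the finest partition; the roots are the vertices left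
  after collapsing its cells.\<close>

definition roots :: "nat set" where
  "roots = {v \<in> V. \<rho> k v = v}"

text \<open>These label the new edges to be contracted for the \<open>i\<close>-th
  partition.\<close>

definition moved :: "nat \<Rightarrow> nat set" where
  "moved i = {r \<in> roots. \<rho> i r \<noteq> r}"

text \<open>For a root outside \<open>moved 0\<close> the set under \<open>Max\<close> is empty and
  the value arbitrary; only members of \<open>moved 0\<close> label edges.\<close>

definition parent :: "nat \<Rightarrow> nat" where
  "parent r = \<rho> (Max {j. j \<le> k \<and> \<rho> j r \<noteq> r}) r"

lemma roots_eq: "roots = \<rho> k ` V"
  using min_in[of k] min_idem[of k] by (force simp: roots_def)

lemma finite_moved: "finite (moved i)"
  using finite_V by (simp add: moved_def roots_def)

lemma moved_last: "moved k = {}"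
  by (auto simp: moved_def roots_def)

lemma moved_antimono:
  assumes "i \<le> j" "j \<le> k"
  shows "moved j \<subseteq> moved i"
proof
  fix r assume r: "r \<in> moved j"
  then have "r \<in> V" "\<rho> j r \<noteq> r" by (auto simp: moved_def roots_def)
  then have "\<rho> i r \<noteq> r" using min_fine_coarse[OF assms, of r] by auto
  then show "r \<in> moved i" using r by (simp add: moved_def)
qed

text \<open>The parent is the minimum of an \<open>m\<close>-cell with \<open>i \<le> m\<close>.
  Hence it shares the \<open>m\<close>-cell and so the \<open>i\<close>-cell of \<open>r\<close>,
  and it stays least in the finest partition.\<close>

lemma parent:
  assumes "r \<in> moved i" "i \<le> k"
  shows "parent r < r" "parent r \<in> roots" "\<rho> i (parent r) = \<rho> i r"
proof -
  define m where "m = Max {j. j \<le> k \<and> \<rho> j r \<noteq> r}"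
  have r: "r \<in> V" "\<rho> i r \<noteq> r" using assms by (auto simp: moved_def roots_def)
  have fin: "finite {j. j \<le> k \<and> \<rho> j r \<noteq> r}" by simp
  have "m \<in> {j. j \<le> k \<and> \<rho> j r \<noteq> r}" unfolding m_def by (rule Max_in) (use fin r assms in auto)
  then have m: "m \<le> k" "\<rho> m r \<noteq> r" by auto
  \<comment> \<open>Membership of \<open>r\<close> in \<open>moved i\<close> makes \<open>i\<close>
    one of the candidates for the maximum.\<close>
  have im: "i \<le> m" unfolding m_def by (rule Max_ge) (use r assms in auto)
  have p: "parent r = \<rho> m r" by (simp add: parent_def m_def)
  show "parent r < r" using p m min_le[of m r] r by simp
  show "parent r \<in> roots" using p m min_in[of m r] min_fine_coarse[of m k r] r by (simp add: roots_def)
  show "\<rho> i (parent r) = \<rho> i r" using p min_coarse_fine[OF im m(1) r(1)] by simp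
qed

text \<open>Parent edges in \<open>moved i\<close> stay inside \<open>i\<close>-cells. Conversely,
  following parents from a root strictly decreases until the minimum of its \<open>i\<close>-cell is
  reached.\<close>

lemma edge_conn_moved:
  assumes i: "i \<le> k" and g: "\<And>r. g (h r) = {r, parent r}" and uv: "u \<in> roots" "v \<in> roots"
  shows "(u, v) \<in> edge_conn g (h ` moved i) \<longleftrightarrow> \<rho> i u = \<rho> i v"
proof
  assume "(u, v) \<in> edge_conn g (h ` moved i)"
  then show "\<rho> i u = \<rho> i v"
    unfolding edge_conn_def
    by (induction rule: rtrancl_induct) (use g parent(3)[OF _ i] in auto)
next
  have conn: "(u, \<rho> i u) \<in> edge_conn g (h ` moved i)" if "u \<in> roots" for u
    using that
  proof (induction u rule: less_induct)
    case (less u)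
    show ?case
    proof (cases "\<rho> i u = u")
      case True
      then show ?thesis by simp
    next
      case False
      then have u: "u \<in> moved i" using less.prems by (simp add: moved_def)
      then have "(u, parent u) \<in> edge_conn g (h ` moved i)"
        using g by (intro edge_conn_edge[of "h u"]) auto
      moreover have "(parent u, \<rho> i u) \<in> edge_conn g (h ` moved i)"
        using less.IH[OF parent(1,2)[OF u i]] parent(3)[OF u i] by simp
      ultimately show ?thesis by (rule edge_conn_trans)
    qed
  qed
  assume "\<rho> i u = \<rho> i v"
  then show "(u, v) \<in> edge_conn g (h ` moved i)"
    using conn[OF uv(1)] conn[OF uv(2)] by (metis edge_conn_sym edge_conn_trans)
qed

text \<open>The witness \<open>\<rho> (Suc i) v\<close> is least in its cell at \<open>Suc i\<close>
  but not at \<open>i\<close>.\<close>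

lemma moved_strict:
  assumes "Suc i \<le> k" "v \<in> V" "\<rho> i v \<noteq> \<rho> (Suc i) v"
  shows "moved i - moved (Suc i) \<noteq> {}"
proof -
  let ?r = "\<rho> (Suc i) v"
  have "\<rho> k ?r = ?r" "?r \<in> V" "\<rho> (Suc i) ?r = ?r" "\<rho> i ?r = \<rho> i v"
    using assms min_fine_coarse min_in min_idem min_coarse_fine[of i "Suc i" v] by auto
  then have "?r \<in> moved i - moved (Suc i)" using assms(3) by (simp add: moved_def roots_def)
  then show ?thesis by blast
qed

end

section \<open>Least elements of cells\<close>

definition cell_min :: "nat set set \<Rightarrow> nat \<Rightarrow> nat" where
  "cell_min P v = (LEAST w. \<exists>A\<in>P. v \<in> A \<and> w \<in> A)"

lemma cell_min_cell:
  assumes "partition_on V P" "A \<in> P" "v \<in> A"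
  shows "cell_min P v \<in> A" "cell_min P v \<le> v" "cell_min P v = (LEAST w. w \<in> A)"
proof -
  have "(\<lambda>w. \<exists>A\<in>P. v \<in> A \<and> w \<in> A) = (\<lambda>w. w \<in> A)"
    using partition_on_cell_unique[OF assms(1)] assms(2,3) by blast
  then show *: "cell_min P v = (LEAST w. w \<in> A)" unfolding cell_min_def by simp
  show "cell_min P v \<in> A" "cell_min P v \<le> v"
    unfolding * using assms(3) by (auto intro: LeastI Least_le)
qed

text \<open>Cells with the same least element meet, hence coincide; so the cells are the fibres of
  \<open>cell_min P\<close> on \<open>V\<close>.\<close>

lemma cell_min_eq_iff:
  assumes P: "partition_on V P" and "u \<in> V" "v \<in> V"
  shows "cell_min P u = cell_min P v \<longleftrightarrow> (\<exists>A\<in>P. u \<in> A \<and> v \<in> A)"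
proof
  obtain A where A: "A \<in> P" "u \<in> A" using partition_on_cell_obtain[OF P assms(2)] .
  obtain B where B: "B \<in> P" "v \<in> B" using partition_on_cell_obtain[OF P assms(3)] .
  assume "cell_min P u = cell_min P v"
  then have "A = B"
    using cell_min_cell(1)[OF P A] cell_min_cell(1)[OF P B] partition_on_cell_unique[OF P A(1) B(1)]
    by simp
  then show "\<exists>A\<in>P. u \<in> A \<and> v \<in> A" using A B by blast
next
  assume "\<exists>A\<in>P. u \<in> A \<and> v \<in> A"
  then show "cell_min P u = cell_min P v" using cell_min_cell(3)[OF P] by metis
qed

lemma cell_min_refines:
  assumes ref: "refines V Q P" and uv: "u \<in> V" "v \<in> V" "cell_min Q u = cell_min Q v"
  shows "cell_min P u = cell_min P v"
proof -
  have part: "partition_on V Q" "partition_on V P" using ref by (auto simp: refines_def)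
  obtain A where A: "A \<in> Q" "u \<in> A" "v \<in> A" using cell_min_eq_iff[OF part(1) uv(1,2)] uv(3) by blast
  then obtain B where "B \<in> P" "A \<subseteq> B" using ref unfolding refines_def by blast
  then show ?thesis using cell_min_eq_iff[OF part(2) uv(1,2)] A by blast
qed

text \<open>A partition is determined by the fibres of \<open>cell_min\<close>; the two inclusions
  are symmetric.\<close>

lemma partition_eq_if_cell_min_eq:
  assumes P: "partition_on V P" and Q: "partition_on V Q"
    and eq: "\<And>v. v \<in> V \<Longrightarrow> cell_min P v = cell_min Q v"
  shows "P = Q"
proof -
  have "P \<subseteq> Q" if P: "partition_on V P" and Q: "partition_on V Q"
    and eq: "\<And>v. v \<in> V \<Longrightarrow> cell_min P v = cell_min Q v" for P Q
  proof
    fix A assume A: "A \<in> P"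
    then obtain a where a: "a \<in> A" using partition_onD3[OF P] by (metis ex_in_conv)
    then have aV: "a \<in> V" using A partition_onD1[OF P] by blast
    obtain B where B: "B \<in> Q" "a \<in> B" using partition_on_cell_obtain[OF Q aV] .
    have "x \<in> A \<longleftrightarrow> x \<in> B" for x
    proof (cases "x \<in> V")
      case True
      then have "(\<exists>A\<in>P. a \<in> A \<and> x \<in> A) \<longleftrightarrow> (\<exists>A\<in>Q. a \<in> A \<and> x \<in> A)"
        using cell_min_eq_iff[OF P aV True] cell_min_eq_iff[OF Q aV True] eq aV by simp
      moreover have "(\<exists>A\<in>P. a \<in> A \<and> x \<in> A) \<longleftrightarrow> x \<in> A"
        by (metis partition_on_cell_unique[OF P A _ a] A a)
      moreover have "(\<exists>B\<in>Q. a \<in> B \<and> x \<in> B) \<longleftrightarrow> x \<in> B"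
        by (metis partition_on_cell_unique[OF Q B(1) _ B(2)] B)
      ultimately show ?thesis by simp
    next
      case False
      then show ?thesis using A B partition_onD1[OF P] partition_onD1[OF Q] by blast
    qed
    then show "A \<in> Q" using B by (metis set_eqI)
  qed
  from this[OF P Q eq] this[OF Q P eq[symmetric]] show ?thesis by blast
qed

section \<open>Construction of the graphic major\<close>

lemma graphic_major_if_graphic_flag_matroid:
  assumes flag: "flag_matroid E Ms" and gf: "graphic_flag_matroid E Ms"
  shows "\<exists>Q :: ('a + nat) matroid. major E Ms Q \<and> graphic_matroid Q"
proof -
  obtain G :: "(nat, 'a) multigraph" and Ps where G: "is_multigraph G" "edges G = E"
    and part: "\<forall>P\<in>set Ps. partition_on (verts G) P"
    and succ: "successively (\<lambda>P Q. refines (verts G) Q P \<and> Q \<noteq> P) Ps"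
    and Ms: "Ms = map (partition_matroid G) Ps"
    using gf unfolding graphic_flag_matroid_def by blast
  \<comment> \<open>The partitions are numbered from \<open>0\<close> to \<open>k\<close>, so there
    are \<open>k\<close> blocks.\<close>
  define k where "k = length Ps - 1"
  have len: "length Ps = Suc k" using flag Ms by (cases Ps) (auto simp: flag_matroid_def k_def)
  let ?V = "verts G"
  define \<rho> where "\<rho> i = cell_min (Ps ! i)" for i
  have P: "partition_on ?V (Ps ! i)" if "i \<le> k" for i using part that len by simp
  have ref: "refines ?V (Ps ! Suc i) (Ps ! i)" "Ps ! Suc i \<noteq> Ps ! i" if "Suc i \<le> k" for i
    using succ that len by (auto simp: successively_conv_nth)
  interpret nested_minima ?V k \<rho>
  proof
    show "finite ?V" using G by (simp add: is_multigraph_def)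
    fix i v assume iv: "i \<le> k" "v \<in> ?V"
    obtain A where A: "A \<in> Ps ! i" "v \<in> A" using partition_on_cell_obtain[OF P iv(2)] iv(1) .
    note m = cell_min_cell[OF P[OF iv(1)] A]
    show "\<rho> i v \<in> ?V" using m(1) A partition_onD1[OF P[OF iv(1)]] by (auto simp: \<rho>_def)
    show "\<rho> i v \<le> v" using m(2) by (simp add: \<rho>_def)
    show "\<rho> i (\<rho> i v) = \<rho> i v"
      using m(3) cell_min_cell(3)[OF P[OF iv(1)] A(1) m(1)] by (simp add: \<rho>_def)
  next
    fix i j u v assume "i \<le> j" "j \<le> k" and uv: "u \<in> ?V" "v \<in> ?V" and "\<rho> j u = \<rho> j v"
    then show "\<rho> i u = \<rho> i v"
    \<comment> \<open>Refinement is given for neighbouring partitions only, so coarsening proceeds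
      one index at a time.\<close>
    proof (induction j rule: dec_induct)
      case (step j)
      then show ?case using cell_min_refines[OF ref(1)[of j] uv] by (simp add: \<rho>_def)
    qed
  qed
  \<comment> \<open>Old edges have their ends collapsed by \<open>\<rho> k\<close>; new edges carry
    their larger end as label.\<close>
  define H where "H = \<lparr>verts = roots, edges = E <+> moved 0,
    ends = case_sum (\<lambda>e. \<rho> k ` ends G e) (\<lambda>r. {r, parent r})\<rparr>"
  have endsH: "ends H (Inl e) = \<rho> k ` ends G e" "ends H (Inr r) = {r, parent r}" for e r
    by (auto simp: H_def)
  have moved_roots: "moved i \<subseteq> roots" for i by (auto simp: moved_def)
  have "ends H e \<subseteq> roots \<and> card (ends H e) \<in> {1, 2}" if e: "e \<in> edges H" for e
  proof -
    have "\<exists>a\<in>roots. \<exists>b\<in>roots. ends H e = {a, b}"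
    proof (cases e)
      case (Inl f)
      then have "f \<in> edges G" using e G(2) by (auto simp: H_def)
      then obtain a b where "a \<in> ?V" "b \<in> ?V" "ends G f = {a, b}"
        using multigraph_ends[OF G(1)] by blast
      then show ?thesis using Inl by (auto simp: endsH roots_eq)
    next
      case (Inr r)
      then have "r \<in> moved 0" using e by (auto simp: H_def)
      then show ?thesis using Inr parent(2)[of r 0] moved_roots[of 0] by (auto simp: endsH)
    qed
    then obtain a b where "a \<in> roots" "b \<in> roots" "ends H e = {a, b}" by blast
    then show ?thesis by (cases "a = b") auto
  qed
  then have H: "is_multigraph H"
    using finite_V finite_moved flag
    by (auto simp: is_multigraph_def H_def roots_def flag_matroid_def)
  have fX: "forest (ends H) (Inr ` moved i)" if "i \<le> k" for i
    by (rule parent_edges_forest[of _ _ _ parent]) (use finite_moved parent(1) that endsH in auto)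
  \<comment> \<open>A root is in block \<open>i\<close> when \<open>i\<close> is the last index at
    which it is not least in its cell.\<close>
  define Xs where "Xs = map (\<lambda>i. moved i - moved (Suc i)) [0..<k]"
  have tele: "(\<Union>j\<in>{i..<k}. moved j - moved (Suc j)) = moved i" if "i \<le> k" for i
    using antimono_telescope[of k moved i] moved_antimono moved_last that by simp
  have drop: "\<Union>(set (drop i Xs)) = moved i" if "i \<le> k" for i
    using tele[OF that] by (simp add: Xs_def drop_map)
  have all: "\<Union>(set Xs) = moved 0" using drop[of 0] by simp
  have ne: "moved i - moved (Suc i) \<noteq> {}" if "i < k" for i
  proof -
    \<comment> \<open>Consecutive partitions differ, so their minima differ at some vertex.\<close>
    have "\<exists>v\<in>?V. \<rho> i v \<noteq> \<rho> (Suc i) v"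
      using partition_eq_if_cell_min_eq[of ?V "Ps ! Suc i" "Ps ! i"] P[of i] P[of "Suc i"]
        ref(2)[of i] that by (fastforce simp: \<rho>_def)
    then show ?thesis using moved_strict that by (metis Suc_leI)
  qed
  have dj: "(moved i - moved (Suc i)) \<inter> (moved j - moved (Suc j)) = {}" if "i < j" "j < k" for i j
    using moved_antimono[of "Suc i" j] that by auto
  then have dj': "(moved i - moved (Suc i)) \<inter> (moved j - moved (Suc j)) = {}"
    if "i \<noteq> j" "i < k" "j < k" for i j
    using that by (metis Int_commute linorder_neqE_nat)
  have dist: "distinct Xs"
    unfolding Xs_def distinct_map
  proof (intro conjI inj_onI)
    fix i j assume ij: "i \<in> set [0..<k]" "j \<in> set [0..<k]"
      and eq: "moved i - moved (Suc i) = moved j - moved (Suc j)"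
    show "i = j"
    proof (rule ccontr)
      assume "i \<noteq> j"
      then have "(moved i - moved (Suc i)) \<inter> (moved j - moved (Suc j)) = {}" using dj' ij by simp
      then show False unfolding eq using ne[of j] ij by simp
    qed
  qed simp
  have "partition_on (moved 0) (set Xs)"
  proof (rule partition_onI)
    show "disjnt p q" if pq: "p \<in> set Xs" "q \<in> set Xs" "p \<noteq> q" for p q
    proof -
      obtain i j where "i < k" "p = moved i - moved (Suc i)" "j < k" "q = moved j - moved (Suc j)"
        using pq(1,2) by (auto simp: Xs_def)
      then show ?thesis unfolding disjnt_def using dj'[of i j] pq(3) by metis
    qed
    show "{} \<notin> set Xs"
    proof
      assume "{} \<in> set Xs"
      then obtain i where "i < k" "moved i - moved (Suc i) = {}" by (auto simp: Xs_def)
      then show False using ne by blast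
    qed
  qed (rule all)
  moreover have "relabel Inl (Ms ! i) = delete (contract (cycle_matroid H)
      (Inr ` \<Union>(set (drop i Xs)))) (Inr ` \<Union>(set (take i Xs)))" if "i < length Ms" for i
  proof -
    have i: "i \<le> k" using that Ms len by simp
    have "relabel Inl (partition_matroid G (Ps ! i)) = delete (contract (cycle_matroid H)
      (Inr ` \<Union>(set (drop i Xs)))) (Inr ` \<Union>(set (take i Xs)))"
    proof (rule relabel_partition_matroid_eq_minor[OF H _ fX[of 0]])
      show "edges H = edges G <+> moved 0" using G by (simp add: H_def)
      show "moved 0 = \<Union>(set (drop i Xs)) \<union> \<Union>(set (take i Xs))"
        using all by (metis Sup_union_distrib append_take_drop_id set_append sup_commute)
      show "cells_by_forest G (Ps ! i) (ends H) (Inr ` \<Union>(set (drop i Xs))) Inl (\<rho> k)"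
        unfolding drop[OF i]
      proof
        fix u v assume uv: "u \<in> ?V" "v \<in> ?V"
        have "(\<exists>A\<in>Ps ! i. u \<in> A \<and> v \<in> A) \<longleftrightarrow> \<rho> i u = \<rho> i v"
          using cell_min_eq_iff[OF P[OF i] uv] by (simp add: \<rho>_def)
        \<comment> \<open>Passing to \<open>\<rho> k u\<close> and \<open>\<rho> k v\<close> gives
          roots, to which \<open>edge_conn_moved\<close> applies.\<close>
        also have "\<dots> \<longleftrightarrow> \<rho> i (\<rho> k u) = \<rho> i (\<rho> k v)" using min_coarse_fine[of i k] i uv by simp
        also have "\<dots> \<longleftrightarrow> (\<rho> k u, \<rho> k v) \<in> edge_conn (ends H) (Inr ` moved i)"
          using edge_conn_moved[of i "ends H" Inr "\<rho> k u" "\<rho> k v"] i uv endsH by (simp add: roots_eq)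
        finally show "(\<exists>A\<in>Ps ! i. u \<in> A \<and> v \<in> A) \<longleftrightarrow>
          (\<rho> k u, \<rho> k v) \<in> edge_conn (ends H) (Inr ` moved i)" .
      next
        fix c :: "'a + nat" assume "c \<in> Inr ` moved i"
        then show "ends H c \<subseteq> \<rho> k ` ?V"
          using parent(2)[OF _ i] moved_roots[of i] by (auto simp: endsH simp flip: roots_eq)
      qed (use G P[OF i] fX[OF i] endsH in auto)
    qed simp
    then show ?thesis using that Ms by simp
  qed
  moreover have "ground (cycle_matroid H) = E <+> moved 0"
    by (simp add: cycle_matroid_def H_def)
  moreover have "Inr ` moved 0 \<in> indep (cycle_matroid H)"
    unfolding indep_cycle_matroid[OF H] using fX[of 0] by (auto simp: H_def)
  moreover have "length Xs = length Ms - 1" using Ms len by (simp add: Xs_def)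
  ultimately have "major E Ms (cycle_matroid H)"
    unfolding major_def using is_matroid_cycle_matroid[OF H] dist
    by (intro conjI exI[of _ "moved 0"] exI[of _ Xs]) auto
  then show ?thesis using H by (auto simp: graphic_matroid_def)
qed

theorem theorem3p24:
  fixes E :: "'a set" and Ms :: "'a matroid list"
  assumes "flag_matroid E Ms"
  shows "graphic_flag_matroid E Ms \<longleftrightarrow>
    (\<exists>Q :: ('a + nat) matroid. major E Ms Q \<and> graphic_matroid Q)"
  using graphic_flag_matroid_if_graphic_major[OF assms]
    graphic_major_if_graphic_flag_matroid[OF assms] by blast

end
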